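(* Let $X$ be a nonzero Banach space and $E$ be a Banach lattice. Then the following statements are equivalent: (1) Every semi-compact operator $T:X\rightarrow E$ is almost L-weakly compact; (2) The norm of $E$ is order continuous.
   Context: All Banach spaces and Banach lattices are real, and operators are continuous linear maps. $B_X$ denotes the closed unit ball of $X$, and $E_+$ the positive cone of $E$. An operator $T:X\to E$ from a Banach space to a Banach lattice is semi-compact if for each $\varepsilon>0$ there exists $u\in E_+$ such that $T(B_X)\subset[-u,u]+\varepsilon B_E$. A nonempty norm bounded subset $A$ of a Banach lattice $E$ is L-weakly compact if $\|y_n\|\to 0$ for every disjoint sequence $(y_n)$ contained in the solid hull $\{y\in E: |y|\le |a| \text{ for some } a\in A\}$ of $A$. An operator $T$ from a Banach space $X$ into a Banach lattice $E$ is almost L-weakly compact if $T$ maps relatively weakly compact subsets of $X$ onto L-weakly compact subsets of $E$. The norm of a Banach lattice $E$ is order continuous if $\|x_\alpha\|\downarrow 0$ for every net $(x_\alpha)$ in $E$ with $x_\alpha\downarrow 0$. *)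

theory Defs
  imports
    "HOL-Analysis.Analysis"
    "HOL-Library.Lattice_Algebras"
    "HOL-Library.Lub_Glb"
    "HOL-Library.Set_Algebras"
begin

text \<open>The assumption \<open>abs_lattice\<close> of \<open>lattice_ab_group_add_abs\<close> makes the modulus
  the lattice one, \<open>\<bar>x\<bar> = sup x (- x)\<close>.\<close>

class banach_lattice = banach + ordered_real_vector + lattice_ab_group_add_abs +
  assumes norm_mono_abs: "\<bar>x\<bar> \<le> \<bar>y\<bar> \<Longrightarrow> norm x \<le> norm y"

instance real :: banach_lattice
  by standard simp

text \<open>The weak topology is the initial topology for the evaluations \<open>x \<mapsto> f x\<close>, \<open>f\<close> a continuous
  linear functional: functions carry the product topology, so pulling it back along
  \<open>x \<mapsto> (f \<mapsto> f x)\<close> is the same thing.\<close>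

definition weak_topology :: "'a::real_normed_vector topology" where
  "weak_topology =
     pullback_topology UNIV (\<lambda>x (f :: 'a \<Rightarrow>\<^sub>L real). blinfun_apply f x) euclidean"

definition relatively_weakly_compact :: "'a::real_normed_vector set \<Rightarrow> bool" where
  "relatively_weakly_compact A \<longleftrightarrow> compactin weak_topology (weak_topology closure_of A)"

definition semi_compact :: "('x::banach \<Rightarrow>\<^sub>L 'e::banach_lattice) \<Rightarrow> bool" where
  "semi_compact T \<longleftrightarrow>
     (\<forall>\<epsilon>>0. \<exists>u\<ge>0. blinfun_apply T ` cball 0 1 \<subseteq> {- u..u} + (\<lambda>b. \<epsilon> *\<^sub>R b) ` cball 0 1)"

definition solid_hull :: "'e::banach_lattice set \<Rightarrow> 'e set" where
  "solid_hull A = {y. \<exists>a\<in>A. \<bar>y\<bar> \<le> \<bar>a\<bar>}"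

definition disjoint_sequence :: "(nat \<Rightarrow> 'e::banach_lattice) \<Rightarrow> bool" where
  "disjoint_sequence y \<longleftrightarrow> (\<forall>m n. m \<noteq> n \<longrightarrow> inf \<bar>y m\<bar> \<bar>y n\<bar> = 0)"

definition L_weakly_compact :: "'e::banach_lattice set \<Rightarrow> bool" where
  "L_weakly_compact A \<longleftrightarrow> A \<noteq> {} \<and> bounded A \<and>
     (\<forall>y. disjoint_sequence y \<and> range y \<subseteq> solid_hull A \<longrightarrow> (\<lambda>n. norm (y n)) \<longlonglongrightarrow> 0)"

text \<open>L-weakly compact sets are nonempty by definition, so the empty set, which is relatively
  weakly compact, has to be left out here.\<close>

definition almost_L_weakly_compact :: "('x::banach \<Rightarrow>\<^sub>L 'e::banach_lattice) \<Rightarrow> bool" where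
  "almost_L_weakly_compact T \<longleftrightarrow>
     (\<forall>A. A \<noteq> {} \<and> relatively_weakly_compact A \<longrightarrow> L_weakly_compact (blinfun_apply T ` A))"

text \<open>Nets are families indexed by a directed preorder \<open>r\<close> on a set \<open>I\<close>; \<open>(i, j) \<in> r\<close> means that
  \<open>j\<close> is the later index.\<close>

definition directed_on :: "'i set \<Rightarrow> 'i rel \<Rightarrow> bool" where
  "directed_on I r \<longleftrightarrow> I \<noteq> {} \<and> preorder_on I r \<and>
     (\<forall>i\<in>I. \<forall>j\<in>I. \<exists>k\<in>I. (i, k) \<in> r \<and> (j, k) \<in> r)"

definition net_decreases_to :: "'i set \<Rightarrow> 'i rel \<Rightarrow> ('i \<Rightarrow> 'a::order) \<Rightarrow> 'a \<Rightarrow> bool" where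
  "net_decreases_to I r x l \<longleftrightarrow> (\<forall>(i, j)\<in>r. x j \<le> x i) \<and> isGlb UNIV (x ` I) l"

text \<open>A definition cannot quantify over the type of indices, so the index sets here are subsets of
  the space itself. The lemma below shows that this covers nets over arbitrary index types: a
  decreasing net can be replaced by its range, directed by the reversed order.\<close>

definition order_continuous_norm :: "'e::banach_lattice itself \<Rightarrow> bool" where
  "order_continuous_norm _ \<longleftrightarrow>
     (\<forall>(I :: 'e set) r (x :: 'e \<Rightarrow> 'e).
        directed_on I r \<and> net_decreases_to I r x 0 \<longrightarrow>
        net_decreases_to I r (\<lambda>i. norm (x i)) 0)"

lemma order_continuous_norm_arbitrary_net:
  fixes I :: "'i set" and x :: "'i \<Rightarrow> 'e::banach_lattice"
  assumes oc: "order_continuous_norm TYPE('e)"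
    and dir: "directed_on I r" and dec: "net_decreases_to I r x 0"
  shows "net_decreases_to I r (\<lambda>i. norm (x i)) 0"
proof -
  define s where "s = {(u, v). u \<in> x ` I \<and> v \<in> x ` I \<and> v \<le> u}"
  have mono: "x j \<le> x i" if "(i, j) \<in> r" for i j
    using dec that unfolding net_decreases_to_def by auto
  have glb: "isGlb UNIV (x ` I) 0"
    using dec unfolding net_decreases_to_def by auto
  have "preorder_on (x ` I) s"
    unfolding preorder_on_def s_def refl_on_def trans_def by auto
  moreover have "\<exists>k\<in>x ` I. (u, k) \<in> s \<and> (v, k) \<in> s" if "u \<in> x ` I" "v \<in> x ` I" for u v
  proof -
    obtain i j where ij: "i \<in> I" "j \<in> I" "u = x i" "v = x j"
      using \<open>u \<in> x ` I\<close> \<open>v \<in> x ` I\<close> by auto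
    then obtain k where "k \<in> I" "(i, k) \<in> r" "(j, k) \<in> r"
      using dir unfolding directed_on_def by blast
    then show ?thesis
      using ij mono unfolding s_def by auto
  qed
  ultimately have "directed_on (x ` I) s"
    using dir unfolding directed_on_def by auto
  moreover have "net_decreases_to (x ` I) s (\<lambda>u. u) 0"
    using glb unfolding net_decreases_to_def s_def by auto
  ultimately have "net_decreases_to (x ` I) s norm 0"
    using oc unfolding order_continuous_norm_def by blast
  then have 1: "isGlb UNIV (norm ` x ` I) 0"
    unfolding net_decreases_to_def by auto
  have "norm (x j) \<le> norm (x i)" if "(i, j) \<in> r" for i j
  proof -
    have "j \<in> I"
      using dir that unfolding directed_on_def preorder_on_def by auto
    then have "0 \<le> x j"
      using glb unfolding isGlb_def isLb_def greatestP_def setge_def by auto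
    with mono[OF that] show ?thesis
      by (intro norm_mono_abs) auto
  qed
  with 1 show ?thesis
    unfolding net_decreases_to_def by (auto simp: image_image)
qed

end

theory Submission
  imports Defs
begin

text \<open>
  Both statements are equivalent to a third one: \<^emph>\<open>every disjoint sequence in an order interval
  \<open>[0, u]\<close> of \<open>E\<close> is norm null\<close>.

  From semi-compact operators to disjoint sequences: rank one operators are enough. For \<open>u \<ge> 0\<close>
  and a functional \<open>f\<close> of norm at most one with \<open>f x = 1\<close> for some \<open>x\<close>, the operator
  \<open>f(-) u\<close> maps the unit ball into \<open>[-u, u]\<close>, so it is semi-compact, and it maps the weakly compact
  set \<open>{x}\<close> onto \<open>{u}\<close>, whose solid hull is \<open>[-u, u]\<close>
  (\<open>disjoint_null_if_semi_compact_almost_L_weakly_compact\<close>).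

  From disjoint sequences to order continuity: the step that needs work is that positive \<open>v n\<close> whose
  partial sums stay below \<open>u\<close> tend to zero (\<open>order_bounded_series_null\<close>). Think of functions with
  \<open>u = 1\<close>. At each point, at most \<open>K\<close> of the \<open>v n\<close> exceed \<open>1 / (K + 1)\<close>; hence any \<open>K + 1\<close> of the
  truncations \<open>(v n - u / (K + 1))\<^sup>+\<close> have infimum zero. Sequences in \<open>[0, u]\<close> with this finite
  multiplicity are null by induction on \<open>K\<close> (\<open>finite_multiplicity_null\<close>): meeting all members with
  a fixed one lowers the multiplicity, so by induction the pairwise meets \<open>w m \<sqinter> w n\<close> tend to zero
  as \<open>n\<close> grows, and after passing to a subsequence one can subtract all the pairwise meets from each
  member and obtain a genuinely disjoint sequence while losing little norm (\<open>almost_disjoint_null\<close>).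
  Consequently decreasing positive nets are norm Cauchy, and the norm limit of a Cauchy decreasing
  net is its infimum.

  From order continuity back to disjoint sequences: the partial sums \<open>s n\<close> of a disjoint sequence in
  \<open>[0, u]\<close> stay below \<open>u\<close>. They need not have a supremum a priori, but the differences \<open>w - s n\<close>,
  with \<open>w\<close> running through all upper bounds of the \<open>s n\<close>, decrease to zero; so some of them are
  small in norm, and they dominate all later terms
  (\<open>disjoint_null_if_order_continuous_norm\<close>).

  From disjoint sequences to semi-compact operators: relatively weakly compact sets are bounded, so
  \<open>T ` A\<close> lies in \<open>[-w, w]\<close> up to a ball of small radius. A disjoint sequence \<open>y n\<close> in its solid
  hull then differs little in norm from \<open>\<bar>y n\<bar> \<sqinter> w\<close>, which is disjoint and order bounded.

  Two facts of functional analysis enter: norming functionals, obtained as minimal sublinear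
  functionals, and the boundedness of weakly bounded sets, by a gliding hump.
\<close>

section \<open>Order and norm in Banach lattices\<close>

lemma norm_abs_lattice [simp]: "norm \<bar>x\<bar> = norm x" for x :: "'e::banach_lattice"
  by (intro order.antisym norm_mono_abs) auto

lemma norm_mono_pos: "0 \<le> x \<Longrightarrow> x \<le> y \<Longrightarrow> norm x \<le> norm y" for x :: "'e::banach_lattice"
  by (intro norm_mono_abs) (simp add: abs_of_nonneg)

text \<open>The negative part of the limit \<open>l\<close> is at most \<open>\<bar>x n - l\<bar>\<close>, so its norm vanishes.\<close>

lemma nonneg_limit:
  fixes x :: "nat \<Rightarrow> 'e::banach_lattice"
  assumes lim: "x \<longlonglongrightarrow> l" and nonneg: "\<And>n. 0 \<le> x n"
  shows "0 \<le> l"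
proof -
  have "norm (pprt (- l)) \<le> norm (x n - l)" for n
  proof -
    have "- l \<le> x n - l" using nonneg[of n] by simp
    also have "\<dots> \<le> \<bar>x n - l\<bar>" by (rule abs_ge_self)
    finally have "pprt (- l) \<le> \<bar>x n - l\<bar>" by (simp add: pprt_def)
    then show ?thesis using norm_mono_pos[of "pprt (- l)" "\<bar>x n - l\<bar>"] by simp
  qed
  moreover have "(\<lambda>n. norm (x n - l)) \<longlonglongrightarrow> 0"
    using lim tendsto_norm_zero LIM_zero by blast
  ultimately have "norm (pprt (- l)) \<le> 0"
    by (intro tendsto_lowerbound[of "\<lambda>n. norm (x n - l)" 0 sequentially]) auto
  then have "pprt (- l) = 0" by simp
  then have "- l \<le> 0" by (simp only: le_zero_iff_zero_pprt)
  then show ?thesis by simp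
qed

lemma le_limit:
  fixes x :: "nat \<Rightarrow> 'e::banach_lattice"
  assumes "x \<longlonglongrightarrow> l" and "\<And>n. a \<le> x n"
  shows "a \<le> l"
  using nonneg_limit[of "\<lambda>n. x n - a" "l - a"] assms by (simp add: tendsto_diff)

lemma archimedean_le_zero:
  fixes v w :: "'e::banach_lattice"
  assumes "\<And>k::nat. real k *\<^sub>R v \<le> w"
  shows "v \<le> 0"
proof -
  have "v \<le> inverse (real (Suc k)) *\<^sub>R w" for k
    using scaleR_left_mono[OF assms[of "Suc k"], of "inverse (real (Suc k))"] by simp
  moreover have "(\<lambda>k. inverse (real (Suc k)) *\<^sub>R w) \<longlonglongrightarrow> 0 *\<^sub>R w"
    by (intro tendsto_scaleR tendsto_const LIMSEQ_inverse_real_of_nat)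
  ultimately show ?thesis using le_limit[of "\<lambda>k. inverse (real (Suc k)) *\<^sub>R w" 0 v] by simp
qed

lemma inf_add_le:
  fixes a b c :: "'e::lattice_ab_group_add"
  assumes "0 \<le> a" "0 \<le> b" "0 \<le> c"
  shows "inf (a + b) c \<le> inf a c + inf b c"
proof -
  let ?t = "inf (a + b) c"
  have "c \<le> c + b" "c \<le> inf a c + c" using assms by simp_all
  then have "?t \<le> inf (a + b) (c + b)" and tc: "?t \<le> inf a c + c"
    by (meson inf_mono order.refl inf_le2 order.trans)+
  then have "?t \<le> inf a c + b" by (simp only: add_inf_distrib_right)
  with tc show ?thesis by (simp only: add_inf_distrib_left inf_greatest)
qed

text \<open>This is an instance of distributivity, which holds in every lattice-ordered group: both positive
  parts exceed that of \<open>inf b c\<close> by at most \<open>b - inf b c\<close> and \<open>c - inf b c\<close>, and these two are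
  disjoint.\<close>

lemma inf_pprt_le:
  fixes b c :: "'e::lattice_ab_group_add"
  shows "inf (pprt b) (pprt c) \<le> pprt (inf b c)"
proof -
  let ?m = "inf b c"
  have "pprt b \<le> pprt ?m + (b - ?m)" "pprt c \<le> pprt ?m + (c - ?m)"
  proof -
    have *: "pprt x \<le> pprt ?m + (x - ?m)" if "?m \<le> x" for x
    proof -
      have "?m \<le> pprt ?m" "0 \<le> x - ?m" using that by (simp_all add: pprt_def del: diff_inf_eq_sup)
      then have "x \<le> pprt ?m + (x - ?m)" "0 \<le> pprt ?m + (x - ?m)"
        by (simp_all only: zero_le_pprt add_nonneg_nonneg) (metis add_right_mono add.commute diff_add_cancel)
      then show ?thesis by (simp only: pprt_def sup_least)
    qed
    show "pprt b \<le> pprt ?m + (b - ?m)" "pprt c \<le> pprt ?m + (c - ?m)"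
      by (rule *, simp)+
  qed
  then have "inf (pprt b) (pprt c) \<le> inf (pprt ?m + (b - ?m)) (pprt ?m + (c - ?m))"
    by (rule inf_mono)
  also have "\<dots> = pprt ?m + inf (b - ?m) (c - ?m)" by (simp only: add_inf_distrib_left)
  also have "inf (b - ?m) (c - ?m) = 0"
    using add_inf_distrib_right[of b c "- ?m"] by (simp only: diff_conv_add_uminus add.right_inverse)
  finally show ?thesis by simp
qed

section \<open>Order bounded sequences when disjoint ones are null\<close>

text \<open>The sum of two disjoint positive elements is their supremum.\<close>

lemma disjoint_sum_le:
  fixes z :: "nat \<Rightarrow> 'e::banach_lattice"
  assumes disj: "disjoint_sequence z" and z: "\<And>n. 0 \<le> z n" "\<And>n. z n \<le> u"
  shows "(\<Sum>i<n. z i) \<le> u"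
proof -
  have d: "inf (z i) (z j) = 0" if "i \<noteq> j" for i j
    using disj that z unfolding disjoint_sequence_def by (metis abs_of_nonneg)
  have dj: "inf (\<Sum>i<n. z i) (z j) \<le> 0" if "n \<le> j" for n j
    using that
  proof (induction n)
    case 0 show ?case by simp
  next
    case (Suc n)
    have "inf (\<Sum>i<Suc n. z i) (z j) \<le> inf (\<Sum>i<n. z i) (z j) + inf (z n) (z j)"
      using z by (simp add: inf_add_le sum_nonneg)
    also have "\<dots> \<le> 0" using Suc d[of n j] by simp
    finally show ?case .
  qed
  show ?thesis
  proof (induction n)
    case 0 show ?case using order.trans[OF z(1)[of 0] z(2)[of 0]] by simp
  next
    case (Suc n)
    have "(\<Sum>i<Suc n. z i) = sup (\<Sum>i<n. z i) (z n) + inf (\<Sum>i<n. z i) (z n)"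
      unfolding sum.lessThan_Suc by (rule add_eq_inf_sup)
    also have "\<dots> \<le> u + 0" using Suc z dj[of n n] by (intro add_mono) auto
    finally show ?case by simp
  qed
qed

text \<open>The reason is a disjointification. If the norms stay above \<open>e\<close> along a subsequence whose pairwise
  meets have summable norms, then \<open>z k = (w k - (\<Sum>j\<noteq>k. w j \<sqinter> w k))\<^sup>+\<close> is a disjoint sequence, since
  \<open>z j \<sqinter> z k\<close> is at most the meet of \<open>w j - w j \<sqinter> w k\<close> and \<open>w k - w j \<sqinter> w k\<close>, which is zero; and
  its norms stay above a positive number if the sums are small.\<close>

lemma almost_disjoint_null:
  fixes w :: "nat \<Rightarrow> 'e::banach_lattice"
  assumes null: "\<And>z. disjoint_sequence z \<Longrightarrow> (\<And>n. 0 \<le> z n \<and> z n \<le> u) \<Longrightarrow> z \<longlonglongrightarrow> 0"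
    and w: "\<And>n. 0 \<le> w n \<and> w n \<le> u"
    and ad: "\<And>m. (\<lambda>n. inf (w m) (w n)) \<longlonglongrightarrow> 0"
  shows "w \<longlonglongrightarrow> 0"
proof (rule ccontr)
  assume "\<not> w \<longlonglongrightarrow> 0"
  then obtain e where e: "e > 0" and "\<forall>N. \<exists>n\<ge>N. e \<le> norm (w n)"
    unfolding LIMSEQ_iff by (auto simp: not_less)
  then have large: "\<exists>n\<ge>N. e \<le> norm (w n)" for N by blast
  \<comment> \<open>Since \<open>(1/4) ^ k \<le> (1/2) ^ j\<close> for \<open>j \<le> k\<close>, this rate bounds all the series \<open>\<Sum>j\<noteq>k. w j \<sqinter> w k\<close> in norm by
    the one geometric series \<open>e / 8 * (1/2) ^ j\<close>, whose sum is \<open>e / 4\<close>.\<close>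
  define \<eta> where "\<eta> k = e / 8 * (1/4) ^ k" for k :: nat
  have \<eta>: "\<eta> k > 0" for k using e by (simp add: \<eta>_def)
  have "\<exists>r. \<forall>k. e \<le> norm (w (r k)) \<and>
     (r k < r (Suc k) \<and> (\<forall>m\<le>r k. norm (inf (w m) (w (r (Suc k)))) \<le> \<eta> (Suc k)))"
  proof (rule dependent_nat_choice)
    show "\<exists>n. e \<le> norm (w n)" using large[of 0] by blast
  next
    fix n k assume "e \<le> norm (w n)"
    have "\<forall>m. \<forall>\<^sub>F j in sequentially. norm (inf (w m) (w j)) < \<eta> (Suc k)"
      using ad \<eta> unfolding tendsto_iff dist_norm by simp
    then have "\<forall>\<^sub>F j in sequentially. \<forall>m\<in>{..n}. norm (inf (w m) (w j)) < \<eta> (Suc k)"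
      by (intro eventually_ball_finite) auto
    then obtain N where N: "\<And>j m. j \<ge> N \<Longrightarrow> m \<le> n \<Longrightarrow> norm (inf (w m) (w j)) < \<eta> (Suc k)"
      unfolding eventually_sequentially by auto
    obtain j where "j \<ge> max N (Suc n)" "e \<le> norm (w j)" using large by blast
    then show "\<exists>j. e \<le> norm (w j) \<and> (n < j \<and> (\<forall>m\<le>n. norm (inf (w m) (w j)) \<le> \<eta> (Suc k)))"
      using N[of j] by (intro exI[of _ j]) (auto intro: less_imp_le)
  qed
  then obtain r where r: "\<And>k. e \<le> norm (w (r k))" "\<And>k. r k < r (Suc k)"
    and rk: "\<And>k m. m \<le> r k \<Longrightarrow> norm (inf (w m) (w (r (Suc k)))) \<le> \<eta> (Suc k)" by blast
  have mono: "strict_mono r" using r(2) by (simp add: strict_mono_Suc_iff)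
  have lt: "norm (inf (w (r j)) (w (r k))) \<le> \<eta> k" if "j < k" for j k
  proof -
    obtain k' where k': "k = Suc k'" using \<open>j < k\<close> by (cases k) auto
    with that have "r j \<le> r k'" using mono by (simp add: strict_mono_less_eq)
    then show ?thesis using rk k' by simp
  qed
  define p where "p k j = (if j = k then 0 else inf (w (r j)) (w (r k)))" for k j
  have p0: "0 \<le> p k j" for k j using w by (simp add: p_def)
  have pn: "norm (p k j) \<le> e / 8 * ((1/2) ^ j)" for k j
  proof -
    have m: "(1/4::real) ^ i \<le> (1/2) ^ j" if "j \<le> i" for i j :: nat
    proof -
      have "(1/4::real) ^ i \<le> (1/2) ^ i" by (intro power_mono) auto
      also have "\<dots> \<le> (1/2) ^ j" using that by (intro power_decreasing) auto
      finally show ?thesis .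
    qed
    consider "j < k" | "j = k" | "k < j" by linarith
    then show ?thesis
    proof cases
      case 1
      then have "norm (p k j) \<le> e / 8 * (1/4) ^ k" using lt[of j k] by (simp add: p_def \<eta>_def)
      also have "\<dots> \<le> e / 8 * (1/2) ^ j" using 1 e by (intro mult_left_mono m) auto
      finally show ?thesis .
    next
      case 2 then show ?thesis using e by (simp add: p_def)
    next
      case 3
      then have "norm (p k j) \<le> e / 8 * (1/4) ^ j"
        using lt[of k j] by (simp add: p_def \<eta>_def inf_commute)
      also have "\<dots> \<le> e / 8 * (1/2) ^ j" using e by (intro mult_left_mono m) auto
      finally show ?thesis .
    qed
  qed
  have geo: "summable (\<lambda>j. e / 8 * ((1/2) ^ j))" by (intro summable_mult summable_geometric) simp
  have sm: "summable (p k)" for k by (rule summable_comparison_test'[OF geo pn])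
  have ns: "norm (suminf (p k)) \<le> e / 4" for k
  proof -
    have "norm (suminf (p k)) \<le> (\<Sum>j. e / 8 * ((1/2) ^ j))"
      by (rule norm_suminf_le[OF pn geo])
    also have "\<dots> = e / 4" by (subst suminf_mult) (simp_all add: suminf_geometric summable_geometric)
    finally show ?thesis .
  qed
  have ple: "p k j \<le> suminf (p k)" for k j
  proof (rule le_limit)
    show "(\<lambda>n. \<Sum>i<n + Suc j. p k i) \<longlonglongrightarrow> suminf (p k)"
      using summable_LIMSEQ[OF sm] by (rule LIMSEQ_ignore_initial_segment)
    fix n show "p k j \<le> (\<Sum>i<n + Suc j. p k i)"
      using sum_mono2[of "{..<n + Suc j}" "{j}" "p k"] p0 by simp
  qed
  define z where "z k = pprt (w (r k) - suminf (p k))" for k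
  have s0: "0 \<le> suminf (p k)" for k using p0 ple order.trans by blast
  have z0: "0 \<le> z k" for k by (simp add: z_def)
  have zu: "z k \<le> u" for k
  proof -
    have "z k \<le> pprt (w (r k))" unfolding z_def by (intro pprt_mono) (simp add: s0)
    then show ?thesis using w[of "r k"] by (simp add: order.trans)
  qed
  have zd: "z k \<le> w (r k) - inf (w (r j)) (w (r k))" if "j \<noteq> k" for j k
  proof -
    have "inf (w (r j)) (w (r k)) \<le> suminf (p k)" using ple[of k j] that by (simp add: p_def)
    then have "w (r k) - suminf (p k) \<le> w (r k) - inf (w (r j)) (w (r k))"
      by (rule diff_left_mono)
    moreover have "0 \<le> w (r k) - inf (w (r j)) (w (r k))" by (simp del: diff_inf_eq_sup)
    ultimately show ?thesis unfolding z_def pprt_def by (rule sup_least)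
  qed
  have "disjoint_sequence z"
    unfolding disjoint_sequence_def
  proof (intro allI impI)
    fix m n :: nat assume mn: "m \<noteq> n"
    let ?a = "w (r m)" and ?b = "w (r n)"
    have "inf (z m) (z n) \<le> inf (?a - inf ?a ?b) (?b - inf ?a ?b)"
      using zd[OF mn] zd[OF mn[symmetric]] by (intro inf_mono) (simp_all only: inf_commute)
    also have "\<dots> = 0"
      using add_inf_distrib_right[of ?a ?b "- inf ?a ?b"]
      by (simp only: diff_conv_add_uminus add.right_inverse)
    finally show "inf \<bar>z m\<bar> \<bar>z n\<bar> = 0" using z0 by (simp add: abs_of_nonneg order.antisym)
  qed
  then have "z \<longlonglongrightarrow> 0" using null[of z] z0 zu by simp
  then obtain k where k: "norm (z k) < e / 2"
    using e unfolding LIMSEQ_iff by (metis diff_zero half_gt_zero order.refl)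
  have "norm (w (r k)) \<le> norm (z k + suminf (p k))"
  proof (rule norm_mono_pos)
    show "0 \<le> w (r k)" using w by simp
    have "w (r k) - suminf (p k) \<le> z k" unfolding z_def pprt_def by simp
    then show "w (r k) \<le> z k + suminf (p k)" by (simp add: diff_le_eq)
  qed
  also have "\<dots> \<le> norm (z k) + norm (suminf (p k))" by (rule norm_triangle_ineq)
  also have "\<dots> < e" using k ns[of k] e by linarith
  finally show False using r(1)[of k] by simp
qed

text \<open>The hypothesis \<open>mult\<close> says that any \<open>K + 1\<close> members of the sequence have infimum at most zero.
  Restricting to indices \<open>n > m\<close>, the sequence \<open>w m \<sqinter> w n\<close> satisfies it with one member fewer, as
  \<open>w m\<close> can be added to any choice of members; so it is null by induction, and the sequence \<open>w\<close> is
  almost disjoint.\<close>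

lemma finite_multiplicity_null:
  fixes w :: "nat \<Rightarrow> 'e::banach_lattice"
  assumes null: "\<And>z. disjoint_sequence z \<Longrightarrow> (\<And>n. 0 \<le> z n \<and> z n \<le> u) \<Longrightarrow> z \<longlonglongrightarrow> 0"
    and w: "\<And>n. 0 \<le> w n \<and> w n \<le> u"
    and mult: "\<And>F a. finite F \<Longrightarrow> card F = Suc K \<Longrightarrow> (\<And>i. i \<in> F \<Longrightarrow> a \<le> w i) \<Longrightarrow> a \<le> 0"
  shows "w \<longlonglongrightarrow> 0"
  using w mult
proof (induction K arbitrary: w)
  case 0
  have "w n \<le> 0" for n using "0.prems"(2)[of "{n}" "w n"] by simp
  then have "w = (\<lambda>_. 0)" using "0.prems"(1) by (intro ext order.antisym) auto
  then show ?case by simp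
next
  case (Suc K)
  show ?case
  proof (rule almost_disjoint_null[OF null])
    fix m
    have "(\<lambda>n. inf (w m) (w (n + Suc m))) \<longlonglongrightarrow> 0"
    proof (rule Suc.IH)
      show "0 \<le> inf (w m) (w (n + Suc m)) \<and> inf (w m) (w (n + Suc m)) \<le> u" for n
        using Suc.prems(1) by (meson inf_greatest inf.coboundedI1)
      fix F :: "nat set" and a
      assume F: "finite F" "card F = Suc K"
        and a: "\<And>i. i \<in> F \<Longrightarrow> a \<le> inf (w m) (w (i + Suc m))"
      let ?G = "insert m ((\<lambda>i. i + Suc m) ` F)"
      obtain i0 where i0: "i0 \<in> F" using F by fastforce
      show "a \<le> 0"
      proof (rule Suc.prems(2))
        show "finite ?G" using F by simp
        have "card ((\<lambda>i. i + Suc m) ` F) = card F" by (intro card_image) (simp add: inj_on_def)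
        moreover have "m \<notin> (\<lambda>i. i + Suc m) ` F" by auto
        ultimately show "card ?G = Suc (Suc K)" using F by simp
        show "a \<le> w i" if "i \<in> ?G" for i using that a i0 by auto
      qed
    qed
    then show "(\<lambda>n. inf (w m) (w n)) \<longlonglongrightarrow> 0" by (rule LIMSEQ_offset)
  qed (use Suc.prems(1) in auto)
qed

text \<open>The witness is the infimum of the \<open>b i\<close>: positive parts commute with finite infima.\<close>

lemma common_lower_bound_pprt:
  fixes b :: "'i \<Rightarrow> 'e::lattice_ab_group_add"
  assumes "finite F" "F \<noteq> {}" "\<And>i. i \<in> F \<Longrightarrow> a \<le> pprt (b i)"
  shows "\<exists>c. (\<forall>i\<in>F. c \<le> b i) \<and> a \<le> pprt c"
  using assms
proof (induction F rule: finite_ne_induct)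
  case (singleton i)
  then show ?case by auto
next
  case (insert i F)
  then obtain c where c: "\<forall>j\<in>F. c \<le> b j" "a \<le> pprt c" by auto
  have "a \<le> inf (pprt (b i)) (pprt c)" using insert.prems[of i] c(2) by simp
  then have "a \<le> pprt (inf (b i) c)" using inf_pprt_le order.trans by blast
  moreover have "\<forall>j\<in>insert i F. inf (b i) c \<le> b j" using c(1) by (auto intro: inf.coboundedI2)
  ultimately show ?case by blast
qed

text \<open>If \<open>c\<close> lies below \<open>v i - u / (K + 1)\<close> for \<open>K + 1\<close> different \<open>i\<close>, then summing gives
  \<open>(K + 1) c \<le> u - u = 0\<close>. So the truncated sequence has finite multiplicity and is null, and the
  truncation costs only \<open>\<parallel>u\<parallel> / (K + 1)\<close> in norm.\<close>

lemma order_bounded_series_null: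
  fixes v :: "nat \<Rightarrow> 'e::banach_lattice"
  assumes null: "\<And>z. disjoint_sequence z \<Longrightarrow> (\<And>n. 0 \<le> z n \<and> z n \<le> u) \<Longrightarrow> z \<longlonglongrightarrow> 0"
    and v: "\<And>n. 0 \<le> v n" and sums: "\<And>n. (\<Sum>i<n. v i) \<le> u"
  shows "v \<longlonglongrightarrow> 0"
proof -
  have sumF: "sum v F \<le> u" if "finite F" for F
  proof -
    from that obtain n where "F \<subseteq> {..<n}" by (auto simp: finite_nat_iff_bounded)
    then have "sum v F \<le> (\<Sum>i<n. v i)" using v by (intro sum_mono2) auto
    then show ?thesis using sums by (rule order.trans)
  qed
  have vu: "v n \<le> u" for n using sumF[of "{n}"] by simp
  have u0: "0 \<le> u" using v[of 0] vu[of 0] by (rule order.trans)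
  have cut: "(\<lambda>n. pprt (v n - inverse (real (Suc K)) *\<^sub>R u)) \<longlonglongrightarrow> 0" for K
  proof (rule finite_multiplicity_null[OF null, where K = K])
    let ?d = "inverse (real (Suc K)) *\<^sub>R u"
    have d0: "0 \<le> ?d" using u0 by (simp add: scaleR_nonneg_nonneg)
    fix n
    have "pprt (v n - ?d) \<le> pprt (v n)" by (intro pprt_mono) (simp only: diff_le_eq le_add_same_cancel1 d0)
    also have "\<dots> = v n" using v by simp
    finally show "0 \<le> pprt (v n - ?d) \<and> pprt (v n - ?d) \<le> u" using vu[of n] by (simp add: order.trans)
  next
    let ?d = "inverse (real (Suc K)) *\<^sub>R u"
    fix F :: "nat set" and a
    assume F: "finite F" "card F = Suc K" and a: "\<And>i. i \<in> F \<Longrightarrow> a \<le> pprt (v i - ?d)"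
    then obtain c where c: "\<forall>i\<in>F. c \<le> v i - ?d" "a \<le> pprt c"
      using common_lower_bound_pprt[of F a "\<lambda>i. v i - ?d"] by fastforce
    have "real (Suc K) *\<^sub>R c = (\<Sum>i\<in>F. c)" using F by (simp add: sum_constant_scaleR)
    also have "\<dots> \<le> (\<Sum>i\<in>F. v i - ?d)" using c by (intro sum_mono) auto
    also have "\<dots> = sum v F - real (Suc K) *\<^sub>R ?d" using F by (simp add: sum_subtractf sum_constant_scaleR)
    also have "\<dots> = sum v F - u" by simp
    also have "\<dots> \<le> 0" using sumF F by simp
    finally have "real (Suc K) *\<^sub>R c \<le> 0" .
    then have "inverse (real (Suc K)) *\<^sub>R (real (Suc K) *\<^sub>R c) \<le> inverse (real (Suc K)) *\<^sub>R 0"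
      by (intro scaleR_left_mono) auto
    then have "c \<le> 0" by simp
    then show "a \<le> 0" using c(2) by simp
  qed
  show ?thesis
  proof (rule metric_LIMSEQ_I)
    fix e :: real assume e: "0 < e"
    have "(\<lambda>K. inverse (real (Suc K)) * norm u) \<longlonglongrightarrow> 0 * norm u"
      by (intro tendsto_mult tendsto_const LIMSEQ_inverse_real_of_nat)
    then have "\<forall>\<^sub>F K in sequentially. inverse (real (Suc K)) * norm u < e / 2"
      using e by (intro order_tendstoD) auto
    then obtain K where K: "inverse (real (Suc K)) * norm u < e / 2"
      by (meson eventually_happens trivial_limit_sequentially)
    let ?d = "inverse (real (Suc K)) *\<^sub>R u"
    obtain N where N: "\<And>n. n \<ge> N \<Longrightarrow> norm (pprt (v n - ?d)) < e / 2"
      using metric_LIMSEQ_D[OF cut[of K], of "e / 2"] e by (auto simp: dist_norm)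
    show "\<exists>N. \<forall>n\<ge>N. dist (v n) 0 < e"
    proof (intro exI[of _ N] allI impI)
      fix n assume "N \<le> n"
      have "v n - ?d \<le> pprt (v n - ?d)" unfolding pprt_def by (rule sup_ge1)
      then have "v n \<le> pprt (v n - ?d) + ?d" by (simp only: diff_le_eq)
      then have "norm (v n) \<le> norm (pprt (v n - ?d) + ?d)" by (rule norm_mono_pos[OF v])
      also have "\<dots> \<le> norm (pprt (v n - ?d)) + norm ?d" by (rule norm_triangle_ineq)
      also have "\<dots> < e" using N[OF \<open>N \<le> n\<close>] K by simp
      finally show "dist (v n) 0 < e" by simp
    qed
  qed
qed

section \<open>Order continuity and disjoint sequences\<close>

lemma isGlb_zero_iff:
  fixes S :: "'a::{order,zero} set"
  shows "isGlb UNIV S 0 \<longleftrightarrow> (\<forall>a\<in>S. 0 \<le> a) \<and> (\<forall>c. (\<forall>a\<in>S. c \<le> a) \<longrightarrow> c \<le> 0)"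
  unfolding isGlb_def isLb_def greatestP_def setge_def setle_def mem_Collect_eq by simp

text \<open>A net without small tails would contain a decreasing sequence whose differences are bounded away
  from zero in norm, although their partial sums stay below its first member. The limit along suitably
  chosen tails is a lower bound of the net, hence zero.\<close>

lemma order_continuous_norm_if_disjoint_null:
  assumes null: "\<And>(u::'e::banach_lattice) z. disjoint_sequence z \<Longrightarrow> (\<And>n. 0 \<le> z n \<and> z n \<le> u) \<Longrightarrow> z \<longlonglongrightarrow> 0"
  shows "order_continuous_norm TYPE('e)"
  unfolding order_continuous_norm_def
proof (intro allI impI, elim conjE)
  fix I :: "'e set" and r and x :: "'e \<Rightarrow> 'e"
  assume dir: "directed_on I r" and dec: "net_decreases_to I r x 0"
  have I: "I \<noteq> {}" and up: "\<And>i j. i \<in> I \<Longrightarrow> j \<in> I \<Longrightarrow> \<exists>k\<in>I. (i, k) \<in> r \<and> (j, k) \<in> r"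
    and rI: "\<And>i j. (i, j) \<in> r \<Longrightarrow> i \<in> I \<and> j \<in> I"
    using dir unfolding directed_on_def preorder_on_def refl_on_def by blast+
  have mono: "x j \<le> x i" if "(i, j) \<in> r" for i j
    using dec that unfolding net_decreases_to_def by auto
  have glb: "isGlb UNIV (x ` I) 0" using dec unfolding net_decreases_to_def by simp
  have x0: "0 \<le> x i" if "i \<in> I" for i using glb that by (simp add: isGlb_zero_iff)
  \<comment> \<open>The net is norm Cauchy.\<close>
  have tail: "\<exists>i\<in>I. \<forall>j. (i, j) \<in> r \<longrightarrow> norm (x i - x j) < e" if e: "e > 0" for e
  proof (rule ccontr)
    assume "\<not> ?thesis"
    then have step: "\<exists>j. (i, j) \<in> r \<and> e \<le> norm (x i - x j)" if "i \<in> I" for i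
      using that by (auto simp: not_less)
    have "\<exists>f. \<forall>n. f n \<in> I \<and> ((f n, f (Suc n)) \<in> r \<and> e \<le> norm (x (f n) - x (f (Suc n))))"
    proof (rule dependent_nat_choice)
      show "\<exists>i. i \<in> I" using I by blast
      show "\<exists>j. j \<in> I \<and> ((i, j) \<in> r \<and> e \<le> norm (x i - x j))" if "i \<in> I" for i and n :: nat
        using step[OF that] rI by blast
    qed
    then obtain f where f: "\<And>n. f n \<in> I" "\<And>n. (f n, f (Suc n)) \<in> r"
      "\<And>n. e \<le> norm (x (f n) - x (f (Suc n)))" by blast
    have "(\<lambda>n. x (f n) - x (f (Suc n))) \<longlonglongrightarrow> 0"
    proof (rule order_bounded_series_null[where u = "x (f 0)"])
      show "0 \<le> x (f n) - x (f (Suc n))" for n using mono[OF f(2)] by simp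
      have "(\<Sum>i<n. x (f i) - x (f (Suc i))) = x (f 0) - x (f n)" for n
        by (rule sum_lessThan_telescope')
      then show "(\<Sum>i<n. x (f i) - x (f (Suc i))) \<le> x (f 0)" for n using x0[OF f(1)[of n]] by simp
    qed (rule null)
    then obtain n where "norm (x (f n) - x (f (Suc n))) < e"
      using metric_LIMSEQ_D[OF _ e] by (fastforce simp: dist_norm)
    then show False using f(3)[of n] by simp
  qed
  have "\<forall>n. \<exists>i\<in>I. \<forall>j. (i, j) \<in> r \<longrightarrow> norm (x i - x j) < (1/2) ^ n" by (intro allI tail) simp
  then obtain a where a: "\<And>n. a n \<in> I" "\<And>n j. (a n, j) \<in> r \<Longrightarrow> norm (x (a n) - x j) < (1/2) ^ n"
    by metis
  have half: "(\<lambda>n. (1/2::real) ^ n) \<longlonglongrightarrow> 0" by (simp add: LIMSEQ_power_zero)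
  have "Cauchy (\<lambda>n. x (a n))"
  proof (rule metric_CauchyI)
    fix e :: real assume "0 < e"
    then obtain N where N: "\<And>n. n \<ge> N \<Longrightarrow> (1/2) ^ n < e / 2"
      using metric_LIMSEQ_D[OF half, of "e / 2"] by auto
    have "dist (x (a m)) (x (a n)) < e" if "m \<ge> N" "n \<ge> N" for m n
    proof -
      obtain k where k: "(a m, k) \<in> r" "(a n, k) \<in> r" using up[OF a(1) a(1)] by blast
      have "dist (x (a m)) (x (a n)) \<le> dist (x (a m)) (x k) + dist (x (a n)) (x k)"
        by (rule dist_triangle2)
      also have "\<dots> < e"
        using a(2)[OF k(1)] a(2)[OF k(2)] N[of m] N[of n] that by (simp add: dist_norm)
      finally show ?thesis .
    qed
    then show "\<exists>M. \<forall>m\<ge>M. \<forall>n\<ge>M. dist (x (a m)) (x (a n)) < e" by blast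
  qed
  then obtain l where l: "(\<lambda>n. x (a n)) \<longlonglongrightarrow> l"
    using Cauchy_convergent_iff convergent_def by blast
  \<comment> \<open>The indices \<open>a n\<close> need not be comparable, so \<open>x i\<close> is compared with \<open>x (a n)\<close> through a common
    later index, beyond \<open>a n\<close> in the tail where the net hardly changes.\<close>
  have "l \<le> x i" if i: "i \<in> I" for i
  proof -
    have "\<forall>n. \<exists>k. (a n, k) \<in> r \<and> (i, k) \<in> r" using up[OF a(1) i] by blast
    then obtain k where k: "\<And>n. (a n, k n) \<in> r" "\<And>n. (i, k n) \<in> r" by metis
    have "(\<lambda>n. x (a n) - x (k n)) \<longlonglongrightarrow> 0"
      using half by (rule Lim_null_comparison[rotated]) (intro always_eventually allI less_imp_le a(2) k)
    then have "(\<lambda>n. x i - x (a n) + (x (a n) - x (k n))) \<longlonglongrightarrow> x i - l + 0"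
      by (intro tendsto_add tendsto_diff tendsto_const l)
    then have "0 \<le> x i - l + 0" by (rule nonneg_limit) (simp add: mono k)
    then show ?thesis by simp
  qed
  then have "l \<le> 0" using glb unfolding isGlb_zero_iff by blast
  moreover have "0 \<le> l" using nonneg_limit[OF l] x0 a(1) by blast
  ultimately have "(\<lambda>n. norm (x (a n))) \<longlonglongrightarrow> 0" using l tendsto_norm_zero by fastforce
  have "isGlb UNIV ((\<lambda>i. norm (x i)) ` I) 0"
    unfolding isGlb_zero_iff
  proof (intro conjI allI impI ballI)
    fix c assume "\<forall>b\<in>(\<lambda>i. norm (x i)) ` I. c \<le> b"
    then have "c \<le> norm (x (a n))" for n using a(1) by blast
    then show "c \<le> 0" using \<open>(\<lambda>n. norm (x (a n))) \<longlonglongrightarrow> 0\<close>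
      by (intro tendsto_lowerbound[of "\<lambda>n. norm (x (a n))" 0 sequentially]) auto
  qed auto
  moreover have "norm (x j) \<le> norm (x i)" if "(i, j) \<in> r" for i j
    using mono[OF that] x0 rI[OF that] by (intro norm_mono_pos) auto
  ultimately show "net_decreases_to I r (\<lambda>i. norm (x i)) 0"
    unfolding net_decreases_to_def by auto
qed

text \<open>That \<open>w - s n\<close> has infimum zero is an Archimedean argument: if \<open>c \<le> w - s n\<close> for all upper bounds
  \<open>w\<close> and all \<open>n\<close>, then \<open>w - c\<close> is again an upper bound, and so is \<open>u - k c\<close> for every \<open>k\<close>; hence
  \<open>k c \<le> u\<close> for all \<open>k\<close>.\<close>

lemma disjoint_null_if_order_continuous_norm:
  fixes z :: "nat \<Rightarrow> 'e::banach_lattice"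
  assumes oc: "order_continuous_norm TYPE('e)"
    and disj: "disjoint_sequence z" and z: "\<And>n. 0 \<le> z n" "\<And>n. z n \<le> u"
  shows "z \<longlonglongrightarrow> 0"
proof -
  define s where "s n = (\<Sum>i<n. z i)" for n
  have s_mono: "s m \<le> s n" if "m \<le> n" for m n
    unfolding s_def using that z by (intro sum_mono2) auto
  define U where "U = {w. \<forall>n. s n \<le> w}"
  have uU: "u \<in> U" using disjoint_sum_le[OF disj z] by (simp add: U_def s_def)
  define I :: "('e \<times> nat) set" where "I = U \<times> UNIV"
  define r where "r = {(p, q). p \<in> I \<and> q \<in> I \<and> fst q \<le> fst p \<and> snd p \<le> snd q}"
  define x where "x p = fst p - s (snd p)" for p :: "'e \<times> nat"
  have "directed_on I r"
  proof -
    have "preorder_on I r" unfolding preorder_on_def refl_on_def trans_def r_def by auto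
    moreover have "\<exists>k\<in>I. (i, k) \<in> r \<and> (j, k) \<in> r" if "i \<in> I" "j \<in> I" for i j
      using that
      by (intro bexI[of _ "(inf (fst i) (fst j), max (snd i) (snd j))"]) (auto simp: r_def I_def U_def)
    moreover have "(u, 0) \<in> I" using uU by (simp add: I_def)
    ultimately show ?thesis unfolding directed_on_def by blast
  qed
  moreover have "net_decreases_to I r x 0"
  proof -
    have "isGlb UNIV (x ` I) 0"
      unfolding isGlb_zero_iff
    proof (intro conjI allI impI ballI)
      show "0 \<le> a" if "a \<in> x ` I" for a using that by (auto simp: x_def I_def U_def)
      fix c assume c: "\<forall>a\<in>x ` I. c \<le> a"
      have step: "w - c \<in> U" if "w \<in> U" for w
      proof -
        have "c \<le> w - s n" for n using bspec[OF c imageI, of "(w, n)"] that by (simp add: x_def I_def)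
        then show ?thesis by (simp add: U_def algebra_simps)
      qed
      have "u - real k *\<^sub>R c \<in> U" for k
      proof (induction k)
        case 0 then show ?case using uU by simp
      next
        case (Suc k)
        then show ?case using step[OF Suc] by (simp add: algebra_simps)
      qed
      then have "s 0 \<le> u - real k *\<^sub>R c" for k unfolding U_def by blast
      then show "c \<le> 0" by (intro archimedean_le_zero[of c u]) (simp add: s_def)
    qed
    moreover have "x j \<le> x i" if "(i, j) \<in> r" for i j
      using that s_mono by (auto simp: r_def x_def intro!: diff_mono)
    ultimately show ?thesis unfolding net_decreases_to_def by auto
  qed
  ultimately have "net_decreases_to I r (\<lambda>i. norm (x i)) 0"
    by (rule order_continuous_norm_arbitrary_net[OF oc])
  then have glb: "isGlb UNIV ((\<lambda>i. norm (x i)) ` I) 0" unfolding net_decreases_to_def by simp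
  show ?thesis
  proof (rule metric_LIMSEQ_I)
    fix e :: real assume "0 < e"
    then obtain b where "b \<in> (\<lambda>i. norm (x i)) ` I" "b < e"
      using glb unfolding isGlb_zero_iff by (meson not_le)
    then obtain w n where wn: "w \<in> U" "norm (w - s n) < e" by (auto simp: x_def I_def)
    have "dist (z m) 0 < e" if "n \<le> m" for m
    proof -
      have "z m = s (Suc m) - s m" by (simp add: s_def)
      also have "\<dots> \<le> w - s n" using wn(1) s_mono[OF that] by (intro diff_mono) (auto simp: U_def)
      finally have "norm (z m) \<le> norm (w - s n)" by (rule norm_mono_pos[OF z(1)])
      then show ?thesis using wn by simp
    qed
    then show "\<exists>N. \<forall>m\<ge>N. dist (z m) 0 < e" by blast
  qed
qed

section \<open>Norming functionals\<close>

definition sublinear :: "('a::real_vector \<Rightarrow> real) \<Rightarrow> bool" where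
  "sublinear p \<longleftrightarrow> (\<forall>x y. p (x + y) \<le> p x + p y) \<and> (\<forall>c\<ge>0. \<forall>x. p (c *\<^sub>R x) = c * p x)"

lemma sublinearI:
  assumes add: "\<And>x y. p (x + y) \<le> p x + p y" and zero: "p 0 = 0"
    and scale: "\<And>c x. c > 0 \<Longrightarrow> p (c *\<^sub>R x) \<le> c * p x"
  shows "sublinear p"
proof -
  have "p (c *\<^sub>R x) = c * p x" if "c \<ge> 0" for c x
  proof (cases "c = 0")
    case False
    with that have c: "c > 0" by simp
    have "p x = p (inverse c *\<^sub>R (c *\<^sub>R x))" using c by simp
    also have "\<dots> \<le> inverse c * p (c *\<^sub>R x)" using c by (intro scale) simp
    finally have "c * p x \<le> p (c *\<^sub>R x)" using c by (simp add: field_simps)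
    with scale[OF c, of x] show ?thesis by simp
  qed (simp add: zero)
  with add show ?thesis unfolding sublinear_def by blast
qed

lemma sublinearD:
  assumes "sublinear p"
  shows "p (x + y) \<le> p x + p y" "c \<ge> 0 \<Longrightarrow> p (c *\<^sub>R x) = c * p x" "p 0 = 0" "- p (- x) \<le> p x"
proof -
  show add: "p (x + y) \<le> p x + p y" for x y using assms unfolding sublinear_def by blast
  show scale: "c \<ge> 0 \<Longrightarrow> p (c *\<^sub>R x) = c * p x" for c x using assms unfolding sublinear_def by blast
  show zero: "p 0 = 0" using scale[of 0 0] by simp
  show "- p (- x) \<le> p x" using add[of x "- x"] zero by simp
qed

text \<open>The witness is \<open>q x = (INF t\<ge>0. p (x + t y) - t p y)\<close>, the construction that makes a sublinear
  functional smaller while it pushes its value at \<open>- y\<close> down to \<open>- p y\<close>. It serves twice: a minimal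
  \<open>p\<close> cannot shrink and is therefore additive, and the norm shrunk along \<open>x\<close> dominates only linear
  functionals that norm \<open>x\<close>.\<close>

lemma sublinear_shrink:
  fixes p :: "'a::real_vector \<Rightarrow> real"
  assumes p: "sublinear p"
  obtains q where "sublinear q" "q \<le> p" "q (- y) \<le> - p y" "\<And>x. q x \<le> p (x + y) - p y"
proof -
  note pD = sublinearD[OF p]
  define g where "g x t = p (x + t *\<^sub>R y) - t * p y" for x t
  define q where "q x = (INF t\<in>{0..}. g x t)" for x
  have lower: "- p (- x) \<le> g x t" if "t \<ge> 0" for x t
    using pD(1)[of "x + t *\<^sub>R y" "- x"] pD(2)[OF that, of y] by (simp add: g_def)
  have bdd: "bdd_below (g x ` {0..})" for x by (rule bdd_belowI2[of _ "- p (- x)"]) (simp add: lower)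
  have q_le: "q x \<le> g x t" if "t \<ge> 0" for x t
    unfolding q_def using that by (intro cINF_lower bdd) simp
  have q_ge: "b \<le> q x" if "\<And>t. t \<ge> 0 \<Longrightarrow> b \<le> g x t" for b x
    unfolding q_def using that by (intro cINF_greatest) auto
  have "sublinear q"
  proof (rule sublinearI)
    fix x z
    have "q (x + z) \<le> g x s + g z t" if "s \<ge> 0" "t \<ge> 0" for s t
    proof -
      have "q (x + z) \<le> g (x + z) (s + t)" using that by (intro q_le) simp
      also have "\<dots> \<le> g x s + g z t"
        using pD(1)[of "x + s *\<^sub>R y" "z + t *\<^sub>R y"] by (simp add: g_def algebra_simps)
      finally show ?thesis .
    qed
    then have "q (x + z) - g x s \<le> q z" if "s \<ge> 0" for s
      using that by (intro q_ge) (simp add: diff_le_eq add.commute)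
    then have "q (x + z) - q z \<le> q x" by (intro q_ge) (simp add: diff_le_eq add.commute)
    then show "q (x + z) \<le> q x + q z" by simp
  next
    have "g 0 t = 0" if "t \<ge> 0" for t using pD(2)[OF that] by (simp add: g_def)
    then show "q 0 = 0" using q_le[of 0 0] q_ge[of 0 0] by (intro order.antisym) auto
  next
    fix c :: real and x assume c: "c > 0"
    have "inverse c * q (c *\<^sub>R x) \<le> q x"
    proof (rule q_ge)
      fix t :: real assume t: "t \<ge> 0"
      have "q (c *\<^sub>R x) \<le> g (c *\<^sub>R x) (c * t)" using c t by (intro q_le) simp
      also have "\<dots> = c * g x t"
        using pD(2)[of c "x + t *\<^sub>R y"] c by (simp add: g_def algebra_simps)
      finally show "inverse c * q (c *\<^sub>R x) \<le> g x t" using c by (simp add: field_simps)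
    qed
    then show "q (c *\<^sub>R x) \<le> c * q x" using c by (simp add: field_simps)
  qed
  moreover have "q \<le> p" using q_le[of 0] by (simp add: le_fun_def g_def)
  moreover have *: "q x \<le> p (x + y) - p y" for x using q_le[of 1 x] by (simp add: g_def)
  moreover have "q (- y) \<le> - p y" using *[of "- y"] pD(3) by simp
  ultimately show ?thesis using that by blast
qed

text \<open>Zorn's lemma applies because the pointwise infimum of a chain of sublinear functionals below \<open>p\<close> is
  finite, being at least \<open>- p (- x)\<close>, and is sublinear.\<close>

lemma minimal_sublinear_exists:
  fixes p :: "'a::real_vector \<Rightarrow> real"
  assumes p: "sublinear p"
  obtains m where "sublinear m" "m \<le> p" "\<And>q. sublinear q \<Longrightarrow> q \<le> m \<Longrightarrow> q = m"
proof -
  define A where "A = {q. sublinear q \<and> q \<le> p}"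
  have "\<exists>m\<in>A. \<forall>a\<in>A. m \<ge> a \<longrightarrow> a = m"
  proof (rule predicate_Zorn)
    show "partial_order_on A (relation_of (\<ge>) A)"
      unfolding partial_order_on_def preorder_on_def refl_on_def trans_def antisym_def relation_of_def
      by auto
    fix C assume C: "C \<in> Chains (relation_of (\<ge>) A)"
    have CA: "q \<in> A" if "q \<in> C" for q using C that unfolding Chains_def relation_of_def by auto
    have tot: "q \<le> q' \<or> q' \<le> q" if "q \<in> C" "q' \<in> C" for q q'
      using C that unfolding Chains_def relation_of_def by auto
    show "\<exists>u\<in>A. \<forall>a\<in>C. a \<ge> u"
    proof (cases "C = {}")
      case True then show ?thesis using p by (auto simp: A_def)
    next
      case False
      define u where "u x = (INF q\<in>C. q x)" for x
      have subl: "sublinear q" "q x \<le> p x" if "q \<in> C" for q x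
        using CA[OF that] by (auto simp: A_def le_fun_def)
      have lower: "- p (- x) \<le> q x" if "q \<in> C" for q x
        using sublinearD(4)[OF subl(1)[OF that], of x] subl(2)[OF that, of "- x"] by linarith
      have bdd: "bdd_below ((\<lambda>q. q x) ` C)" for x
        by (rule bdd_belowI2[of _ "- p (- x)"]) (rule lower)
      have u_le: "u x \<le> q x" if "q \<in> C" for q x
        unfolding u_def using that by (intro cINF_lower bdd)
      have u_ge: "b \<le> u x" if "\<And>q. q \<in> C \<Longrightarrow> b \<le> q x" for b x
        unfolding u_def using that False by (intro cINF_greatest)
      have "sublinear u"
      proof (rule sublinearI)
        fix x z
        have "u (x + z) \<le> q x + q' z" if "q \<in> C" "q' \<in> C" for q q'
        proof -
          have "\<exists>h\<in>C. h \<le> q \<and> h \<le> q'" using tot[OF that] that by auto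
          then obtain h where h: "h \<in> C" "h \<le> q" "h \<le> q'" by blast
          have "u (x + z) \<le> h (x + z)" by (rule u_le[OF h(1)])
          also have "\<dots> \<le> h x + h z" by (rule sublinearD(1)[OF subl(1)[OF h(1)]])
          also have "\<dots> \<le> q x + q' z" using h by (intro add_mono) (auto simp: le_fun_def)
          finally show ?thesis .
        qed
        then have "u (x + z) - q x \<le> u z" if "q \<in> C" for q
          using that by (intro u_ge) (simp add: diff_le_eq add.commute[of _ "q x"])
        then have "u (x + z) - u z \<le> u x" by (intro u_ge) (simp add: diff_le_eq add.commute)
        then show "u (x + z) \<le> u x + u z" by simp
      next
        have zero: "q 0 = 0" if "q \<in> C" for q using sublinearD(3)[OF subl(1)[OF that]] .
        obtain q0 where "q0 \<in> C" using False by blast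
        then have "u 0 \<le> 0" using u_le[of q0 0] zero[of q0] by linarith
        moreover have "0 \<le> u 0" by (rule u_ge) (simp only: zero order.refl)
        ultimately show "u 0 = 0" by simp
      next
        fix c :: real and x assume c: "c > 0"
        have "inverse c * u (c *\<^sub>R x) \<le> u x"
        proof (rule u_ge)
          fix q assume q: "q \<in> C"
          have "u (c *\<^sub>R x) \<le> c * q x"
            using u_le[OF q, of "c *\<^sub>R x"] sublinearD(2)[OF subl(1)[OF q], of c x] c by simp
          then show "inverse c * u (c *\<^sub>R x) \<le> q x" using c by (simp add: field_simps)
        qed
        then show "u (c *\<^sub>R x) \<le> c * u x" using c by (simp add: field_simps)
      qed
      moreover have "u \<le> p"
      proof (rule le_funI)
        fix x
        obtain q0 where q0: "q0 \<in> C" using False by blast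
        show "u x \<le> p x" using u_le[OF q0, of x] subl(2)[OF q0, of x] by linarith
      qed
      ultimately have "u \<in> A" by (simp add: A_def)
      moreover have "u \<le> q" if "q \<in> C" for q using u_le[OF that] by (rule le_funI)
      ultimately show ?thesis by blast
    qed
  qed
  then obtain m where m: "m \<in> A" "\<And>a. a \<in> A \<Longrightarrow> a \<le> m \<Longrightarrow> a = m" by blast
  show ?thesis
  proof (rule that)
    show "sublinear m" "m \<le> p" using m(1) by (auto simp: A_def)
    show "q = m" if "sublinear q" "q \<le> m" for q
      using m that by (intro m(2)) (auto simp: A_def)
  qed
qed

text \<open>Shrinking \<open>m\<close> along \<open>y\<close> gives back \<open>m\<close>, so \<open>m x \<le> m (x + y) - m y\<close>.\<close>

lemma minimal_sublinear_linear:
  assumes m: "sublinear m" and min: "\<And>q. sublinear q \<Longrightarrow> q \<le> m \<Longrightarrow> q = m"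
  shows "linear m"
proof (rule linearI)
  note mD = sublinearD[OF m]
  show add: "m (x + y) = m x + m y" for x y
  proof -
    obtain q where "sublinear q" "q \<le> m" and q: "\<And>x. q x \<le> m (x + y) - m y"
      by (rule sublinear_shrink[OF m, of y]) blast
    then have "q = m" using min by blast
    then have "m x + m y \<le> m (x + y)" using q[of x] by simp
    then show ?thesis using mD(1) by (intro order.antisym)
  qed
  have neg: "m (- x) = - m x" for x using add[of x "- x"] mD(3) by simp
  show "m (c *\<^sub>R x) = c *\<^sub>R m x" for c x
  proof (cases "c \<ge> 0")
    case True then show ?thesis using mD(2) by simp
  next
    case False
    then have "m ((- c) *\<^sub>R x) = (- c) * m x" by (intro mD(2)) simp
    then show ?thesis using neg[of "c *\<^sub>R x"] by simp
  qed
qed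

text \<open>A minimal sublinear functional below the norm shrunk along \<open>x\<close> is linear, and its value at
  \<open>- x\<close> is at most \<open>- \<parallel>x\<parallel>\<close>.\<close>

lemma norming_functional:
  fixes x :: "'a::real_normed_vector"
  obtains f :: "'a \<Rightarrow>\<^sub>L real" where "norm f \<le> 1" "blinfun_apply f x = norm x"
proof -
  have "sublinear (norm :: 'a \<Rightarrow> real)" unfolding sublinear_def by (simp add: norm_triangle_ineq)
  then obtain q where q: "sublinear q" "q \<le> (norm :: 'a \<Rightarrow> real)" "q (- x) \<le> - norm x"
    by (rule sublinear_shrink[where y = x])
  obtain m where m: "sublinear m" "m \<le> q" "\<And>q. sublinear q \<Longrightarrow> q \<le> m \<Longrightarrow> q = m"
    using minimal_sublinear_exists[OF q(1)] by blast
  have lin: "linear m" using m by (intro minimal_sublinear_linear)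
  have le: "m z \<le> norm z" for z using order.trans[OF m(2) q(2)] by (simp add: le_fun_def)
  have neg: "m (- z) = - m z" for z by (rule linear_neg[OF lin])
  have bound: "\<bar>m z\<bar> \<le> norm z" for z using le[of z] le[of "- z"] neg[of z] by simp
  have bl: "bounded_linear m"
    using bound by (intro bounded_linear_intro[where K = 1])
      (simp_all add: linear_add[OF lin] linear_scale[OF lin])
  have "m (- x) \<le> q (- x)" using m(2) by (simp add: le_fun_def)
  then have "m x = norm x" using neg[of x] q(3) le[of x] by simp
  then show ?thesis
    using bound by (intro that[of "Blinfun m"])
      (auto intro: norm_blinfun_bound simp: bounded_linear_Blinfun_apply[OF bl])
qed

section \<open>Weakly bounded sets and the weak topology\<close>

text \<open>If \<open>A\<close> is unbounded, choose \<open>x n\<close> in \<open>A\<close> with norm at least \<open>2 * 3 ^ n * n\<close> and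
  build functionals with \<open>F (n + 1) = F n \<plusminus> (1/3) ^ n g n\<close>, where \<open>g n\<close> norms \<open>x n\<close> and the sign is
  chosen such that \<open>F (n + 1)\<close> has modulus at least \<open>(1/3) ^ n \<parallel>x n\<parallel>\<close> at \<open>x n\<close>. The later steps
  together can cancel only half of this value, so the limit \<open>L\<close> is unbounded on \<open>A\<close>.\<close>

lemma bounded_if_weakly_bounded:
  fixes A :: "'a::real_normed_vector set"
  assumes wb: "\<And>f :: 'a \<Rightarrow>\<^sub>L real. bounded (blinfun_apply f ` A)"
  shows "bounded A"
proof (rule ccontr)
  assume nb: "\<not> bounded A"
  have "\<forall>n. \<exists>x\<in>A. 2 * 3 ^ n * real n \<le> norm x" 
  proof
    fix n :: nat
    show "\<exists>x\<in>A. 2 * 3 ^ n * real n \<le> norm x"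
      using nb unfolding bounded_iff by (auto simp: not_le intro: less_imp_le)
  qed
  then obtain x where xA: "\<And>n. x n \<in> A" and x: "\<And>n. 2 * 3 ^ n * real n \<le> norm (x n)" by metis
  have "\<exists>F :: nat \<Rightarrow> 'a \<Rightarrow>\<^sub>L real. \<forall>n. True \<and> (norm (F (Suc n) - F n) \<le> (1/3) ^ n \<and>
      (1/3) ^ n * norm (x n) \<le> \<bar>blinfun_apply (F (Suc n)) (x n)\<bar>)"
  proof (rule dependent_nat_choice)
    fix f :: "'a \<Rightarrow>\<^sub>L real" and n :: nat
    obtain g :: "'a \<Rightarrow>\<^sub>L real" where g: "norm g \<le> 1" "g (x n) = norm (x n)"
      by (rule norming_functional)
    let ?c = "(1/3::real) ^ n"
    have c0: "0 \<le> ?c * norm (x n)" by simp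
    have n1: "norm (?c *\<^sub>R g) \<le> ?c" using g(1) by (simp add: mult_left_le)
    have "?c * norm (x n) \<le> \<bar>(f + ?c *\<^sub>R g) (x n)\<bar> \<or> ?c * norm (x n) \<le> \<bar>(f - ?c *\<^sub>R g) (x n)\<bar>"
      unfolding blinfun.bilinear_simps g(2) real_scaleR_def
      using c0 by linarith
    then show "\<exists>f' :: 'a \<Rightarrow>\<^sub>L real. True \<and> (norm (f' - f) \<le> ?c \<and> ?c * norm (x n) \<le> \<bar>f' (x n)\<bar>)"
    proof
      assume "?c * norm (x n) \<le> \<bar>(f + ?c *\<^sub>R g) (x n)\<bar>"
      then show ?thesis using n1 by (intro exI[of _ "f + ?c *\<^sub>R g"]) simp
    next
      assume "?c * norm (x n) \<le> \<bar>(f - ?c *\<^sub>R g) (x n)\<bar>"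
      then show ?thesis using n1 by (intro exI[of _ "f - ?c *\<^sub>R g"]) simp
    qed
  qed simp
  then obtain F :: "nat \<Rightarrow> 'a \<Rightarrow>\<^sub>L real"
    where F: "\<And>n. norm (F (Suc n) - F n) \<le> (1/3) ^ n"
      and Fx: "\<And>n. (1/3) ^ n * norm (x n) \<le> \<bar>F (Suc n) (x n)\<bar>" by blast
  have geo: "summable (\<lambda>k. (1/3::real) ^ k)" by (rule summable_geometric) simp
  define d where "d n = F (Suc n) - F n" for n
  have sd: "summable d" using F by (intro summable_comparison_test'[OF geo]) (simp add: d_def)
  define L where "L = F 0 + suminf d"
  have tail: "norm (L - F (Suc n)) \<le> (1/2) * (1/3) ^ n" for n
  proof -
    have "L - F (Suc n) = suminf d - (\<Sum>i<Suc n. d i)"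
      by (simp only: L_def d_def sum_lessThan_telescope) simp
    also have "\<dots> = (\<Sum>k. d (k + Suc n))" using suminf_minus_initial_segment[OF sd, of "Suc n"] by simp
    also have "norm \<dots> \<le> (\<Sum>k. (1/3) ^ Suc n * (1/3) ^ k)"
    proof (rule norm_suminf_le)
      show "norm (d (k + Suc n)) \<le> (1/3) ^ Suc n * (1/3) ^ k" for k
        using F[of "k + Suc n"] unfolding d_def by (simp add: power_add mult.commute)
    qed (intro summable_mult geo)
    also have "\<dots> = (1/2) * (1/3) ^ n" by (subst suminf_mult) (simp_all add: geo suminf_geometric)
    finally show ?thesis .
  qed
  have big: "real n \<le> \<bar>L (x n)\<bar>" for n
  proof -
    have "\<bar>(L - F (Suc n)) (x n)\<bar> \<le> norm (L - F (Suc n)) * norm (x n)"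
      using norm_blinfun[of "L - F (Suc n)" "x n"] by simp
    also have "\<dots> \<le> (1/2) * (1/3) ^ n * norm (x n)" by (intro mult_right_mono tail) simp
    finally have "(1/2) * (1/3) ^ n * norm (x n) \<le> \<bar>L (x n)\<bar>"
      using Fx[of n] abs_triangle_ineq2_sym[of "F (Suc n) (x n)" "L (x n)"]
      by (simp add: blinfun.diff_left)
    moreover have "(1/2) * (1/3) ^ n * (2 * 3 ^ n * real n) \<le> (1/2) * (1/3) ^ n * norm (x n)"
      by (intro mult_left_mono x) simp
    moreover have "(1/2) * (1/3) ^ n * (2 * 3 ^ n * real n) = real n" by (simp add: power_one_over)
    ultimately show ?thesis by linarith
  qed
  obtain B where B: "\<And>a. a \<in> A \<Longrightarrow> \<bar>L a\<bar> \<le> B" using wb[of L] unfolding bounded_iff by auto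
  obtain n :: nat where "B < real n" using reals_Archimedean2 by blast
  then show False using big[of n] B[OF xA[of n]] by linarith
qed

lemma continuous_map_weak_topology_evaluation:
  fixes f :: "'a::real_normed_vector \<Rightarrow>\<^sub>L real"
  shows "continuous_map weak_topology euclidean (blinfun_apply f)"
proof -
  have "continuous_map euclidean euclidean (\<lambda>h. h f)"
    by (simp add: continuous_on_product_coordinates)
  from continuous_map_pullback[OF this] show ?thesis
    unfolding weak_topology_def by (simp add: o_def)
qed

lemma topspace_weak_topology [simp]: "topspace weak_topology = UNIV"
  by (simp add: weak_topology_def topspace_pullback_topology)

text \<open>A functional is weakly continuous, so it is bounded on the weakly compact closure of \<open>A\<close>.\<close>

lemma relatively_weakly_compact_imp_bounded:
  assumes "relatively_weakly_compact A"
  shows "bounded A"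
proof (rule bounded_if_weakly_bounded)
  fix f :: "'a \<Rightarrow>\<^sub>L real"
  have "compactin euclidean (blinfun_apply f ` (weak_topology closure_of A))"
    using assms unfolding relatively_weakly_compact_def
    by (rule image_compactin) (rule continuous_map_weak_topology_evaluation)
  then have "bounded (blinfun_apply f ` (weak_topology closure_of A))"
    by (simp add: compact_imp_bounded)
  then show "bounded (blinfun_apply f ` A)"
    by (rule bounded_subset) (intro image_mono closure_of_subset, simp)
qed

lemma Hausdorff_weak_topology: "Hausdorff_space (weak_topology :: 'a::real_normed_vector topology)"
proof (rule Hausdorff_space_injective_preimage)
  let ?ev = "\<lambda>x (f :: 'a \<Rightarrow>\<^sub>L real). blinfun_apply f x"
  show "continuous_map weak_topology euclidean ?ev"
    using continuous_map_pullback[OF continuous_map_id, of UNIV ?ev euclidean]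
    by (simp add: weak_topology_def o_def)
  show "inj_on ?ev (topspace weak_topology)"
  proof (rule inj_onI)
    fix x y assume eq: "?ev x = ?ev y"
    obtain f :: "'a \<Rightarrow>\<^sub>L real" where "f (x - y) = norm (x - y)" by (rule norming_functional)
    then show "x = y" using fun_cong[OF eq, of f] by (simp add: blinfun.diff_right)
  qed
  show "Hausdorff_space (euclidean :: (('a \<Rightarrow>\<^sub>L real) \<Rightarrow> real) topology)"
    by (simp flip: euclidean_product_topology add: Hausdorff_space_product_topology)
qed

lemma relatively_weakly_compact_singleton: "relatively_weakly_compact {x}"
proof -
  have "weak_topology closure_of {x} = {x}"
    by (intro closure_of_closedin closedin_Hausdorff_singleton Hausdorff_weak_topology) simp
  then show ?thesis by (simp add: relatively_weakly_compact_def)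
qed

section \<open>Semi-compact operators\<close>

lemma semi_compact_rank_one:
  fixes f :: "'x::banach \<Rightarrow>\<^sub>L real" and u :: "'e::banach_lattice"
  assumes f: "norm f \<le> 1" and u: "0 \<le> u"
  shows "semi_compact (blinfun_scaleR_left u o\<^sub>L f)"
  unfolding semi_compact_def
proof (intro allI impI exI[of _ u] conjI subsetI u)
  fix \<epsilon> :: real and y
  assume "\<epsilon> > 0" and "y \<in> blinfun_apply (blinfun_scaleR_left u o\<^sub>L f) ` cball 0 1"
  then obtain x where x: "norm x \<le> 1" "y = f x *\<^sub>R u" by auto
  have "\<bar>f x\<bar> \<le> norm f * norm x" using norm_blinfun[of f x] by simp
  also have "\<dots> \<le> 1" using f x(1) by (simp add: mult_le_one)
  finally have "- 1 \<le> f x" "f x \<le> 1" by linarith+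
  then have "(- 1) *\<^sub>R u \<le> y" "y \<le> 1 *\<^sub>R u"
    unfolding x(2) by (intro scaleR_right_mono u; simp)+
  then have "y + 0 \<in> {- u..u} + (\<lambda>b. \<epsilon> *\<^sub>R b) ` cball 0 1"
    by (intro set_plus_intro) (auto intro: image_eqI[of _ _ 0])
  then show "y \<in> {- u..u} + (\<lambda>b. \<epsilon> *\<^sub>R b) ` cball 0 1" by simp
qed

lemma disjoint_null_if_semi_compact_almost_L_weakly_compact:
  fixes z :: "nat \<Rightarrow> 'e::banach_lattice"
  assumes ex: "\<exists>x :: 'x::banach. x \<noteq> 0"
    and all: "\<And>T :: 'x \<Rightarrow>\<^sub>L 'e. semi_compact T \<Longrightarrow> almost_L_weakly_compact T"
    and disj: "disjoint_sequence z" and z: "\<And>n. 0 \<le> z n \<and> z n \<le> u"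
  shows "z \<longlonglongrightarrow> 0"
proof -
  obtain x :: 'x where x: "x \<noteq> 0" using ex by blast
  obtain f :: "'x \<Rightarrow>\<^sub>L real" where f: "norm f \<le> 1" "f x = norm x" by (rule norming_functional)
  have u: "0 \<le> u" using z[of 0] by (meson order.trans)
  let ?T = "blinfun_scaleR_left u o\<^sub>L f"
  let ?a = "inverse (norm x) *\<^sub>R x"
  have "almost_L_weakly_compact ?T" by (intro all semi_compact_rank_one f u)
  then have "L_weakly_compact (blinfun_apply ?T ` {?a})"
    unfolding almost_L_weakly_compact_def
    by (metis insert_not_empty relatively_weakly_compact_singleton)
  moreover have "blinfun_apply ?T ` {?a} = {u}" using f(2) x by (simp add: blinfun.scaleR_right)
  ultimately have "L_weakly_compact {u}" by simp
  moreover have "range z \<subseteq> solid_hull {u}"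
    using z u by (auto simp: solid_hull_def abs_of_nonneg)
  ultimately have "(\<lambda>n. norm (z n)) \<longlonglongrightarrow> 0"
    using disj unfolding L_weakly_compact_def by blast
  then show ?thesis by (rule tendsto_norm_zero_cancel)
qed

text \<open>For \<open>\<bar>y\<bar> \<le> w + r\<close> with \<open>w, r \<ge> 0\<close> one has \<open>\<bar>y\<bar> \<le> \<bar>y\<bar> \<sqinter> w + r\<close>. Semi-compactness makes \<open>r\<close>
  uniformly small with a fixed \<open>w\<close>, and the meets \<open>\<bar>y n\<bar> \<sqinter> w\<close> are disjoint and order bounded.\<close>

lemma almost_L_weakly_compact_if_semi_compact:
  fixes T :: "'x::banach \<Rightarrow>\<^sub>L 'e::banach_lattice"
  assumes oc: "order_continuous_norm TYPE('e)" and T: "semi_compact T"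
  shows "almost_L_weakly_compact T"
  unfolding almost_L_weakly_compact_def L_weakly_compact_def
proof (intro allI impI conjI; elim conjE)
  fix A :: "'x set" assume "A \<noteq> {}" then show "blinfun_apply T ` A \<noteq> {}" by simp
next
  fix A :: "'x set" assume "relatively_weakly_compact A"
  then show "bounded (blinfun_apply T ` A)"
    by (intro bounded_linear_image blinfun.bounded_linear_right relatively_weakly_compact_imp_bounded)
next
  fix A :: "'x set" and y
  assume A: "relatively_weakly_compact A" and disj: "disjoint_sequence y"
    and y: "range y \<subseteq> solid_hull (blinfun_apply T ` A)"
  obtain c where c: "c > 0" "\<And>a. a \<in> A \<Longrightarrow> norm a \<le> c"
    using relatively_weakly_compact_imp_bounded[OF A] unfolding bounded_pos by blast
  show "(\<lambda>n. norm (y n)) \<longlonglongrightarrow> 0"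
  proof (rule metric_LIMSEQ_I)
    fix e :: real assume e: "0 < e"
    \<comment> \<open>\<open>A\<close> lies in the ball of radius \<open>c\<close>, so the error in semi-compactness gets multiplied by \<open>c\<close>.\<close>
    define \<epsilon> where "\<epsilon> = e / (2 * c)"
    have "\<epsilon> > 0" using e c by (simp add: \<epsilon>_def)
    then obtain u where u: "0 \<le> u"
      and sub: "blinfun_apply T ` cball 0 1 \<subseteq> {- u..u} + (\<lambda>b. \<epsilon> *\<^sub>R b) ` cball 0 1"
      using T unfolding semi_compact_def by blast
    define w where "w = c *\<^sub>R u"
    have w: "0 \<le> w" using u c by (simp add: w_def scaleR_nonneg_nonneg)
    have "\<exists>r. 0 \<le> r \<and> norm r \<le> e / 2 \<and> \<bar>y n\<bar> \<le> w + r" for n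
    proof -
      obtain a where a: "a \<in> A" "\<bar>y n\<bar> \<le> \<bar>T a\<bar>" using y unfolding solid_hull_def by blast
      have "inverse c *\<^sub>R a \<in> cball 0 1" using c a(1) by (simp add: field_simps)
      then have "T (inverse c *\<^sub>R a) \<in> {- u..u} + (\<lambda>b. \<epsilon> *\<^sub>R b) ` cball 0 1" using sub by blast
      then obtain p b where p: "- u \<le> p" "p \<le> u" and b: "norm b \<le> 1"
        and Tp: "T (inverse c *\<^sub>R a) = p + \<epsilon> *\<^sub>R b" by (auto elim!: set_plus_elim)
      have "T a = c *\<^sub>R T (inverse c *\<^sub>R a)" using c by (simp add: blinfun.scaleR_right)
      also have "\<dots> = c *\<^sub>R p + (e / 2) *\<^sub>R b"
        using c by (simp add: Tp scaleR_add_right \<epsilon>_def)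
      finally have Ta: "T a = c *\<^sub>R p + (e / 2) *\<^sub>R b" .
      have "c *\<^sub>R p \<le> w" "- w \<le> c *\<^sub>R p"
        using scaleR_left_mono[OF p(1), of c] scaleR_left_mono[OF p(2), of c] c by (simp_all add: w_def)
      then have "\<bar>c *\<^sub>R p\<bar> \<le> w" by (intro abs_leI) (simp_all add: minus_le_iff)
      then have "\<bar>T a\<bar> \<le> w + \<bar>(e / 2) *\<^sub>R b\<bar>"
        unfolding Ta by (meson abs_triangle_ineq add_right_mono order.trans)
      moreover have "norm \<bar>(e / 2) *\<^sub>R b\<bar> \<le> e / 2" using b e by (simp add: mult_left_le)
      ultimately show ?thesis using a(2) by (intro exI[of _ "\<bar>(e / 2) *\<^sub>R b\<bar>"]) (auto intro: order.trans)
    qed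
    then obtain r where r: "\<And>n. 0 \<le> r n" "\<And>n. norm (r n) \<le> e / 2" "\<And>n. \<bar>y n\<bar> \<le> w + r n"
      by metis
    define z where "z n = inf \<bar>y n\<bar> w" for n
    have z0: "0 \<le> z n" and zw: "z n \<le> w" for n using w by (simp_all add: z_def)
    have "disjoint_sequence z"
      unfolding disjoint_sequence_def
    proof (intro allI impI)
      fix m n :: nat assume "m \<noteq> n"
      have "inf (z m) (z n) \<le> inf \<bar>y m\<bar> \<bar>y n\<bar>" unfolding z_def by (intro inf_mono) simp_all
      also have "\<dots> = 0" using disj \<open>m \<noteq> n\<close> unfolding disjoint_sequence_def by blast
      finally show "inf \<bar>z m\<bar> \<bar>z n\<bar> = 0" using z0 by (simp add: order.antisym)
    qed
    then have "z \<longlonglongrightarrow> 0" by (rule disjoint_null_if_order_continuous_norm[OF oc _ z0 zw])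
    then obtain N where N: "\<And>n. n \<ge> N \<Longrightarrow> norm (z n) < e / 2"
      using metric_LIMSEQ_D[of z 0 "e / 2"] e by (auto simp: dist_norm)
    show "\<exists>N. \<forall>n\<ge>N. dist (norm (y n)) 0 < e"
    proof (intro exI[of _ N] allI impI)
      fix n assume n: "N \<le> n"
      have "\<bar>y n\<bar> \<le> inf (w + r n) \<bar>y n\<bar>" using r(3) by simp
      also have "\<dots> \<le> inf w \<bar>y n\<bar> + inf (r n) \<bar>y n\<bar>" using w r(1) by (simp add: inf_add_le)
      also have "\<dots> \<le> z n + r n" by (intro add_mono) (simp_all add: z_def inf_commute)
      finally have "norm \<bar>y n\<bar> \<le> norm (z n + r n)" by (intro norm_mono_pos) simp_all
      also have "\<dots> \<le> norm (z n) + norm (r n)" by (rule norm_triangle_ineq)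
      also have "\<dots> < e" using N[OF n] r(2)[of n] by linarith
      finally show "dist (norm (y n)) 0 < e" by simp
    qed
  qed
qed

theorem theorem2p1:
  assumes "\<exists>x :: 'x::banach. x \<noteq> 0"
  shows "(\<forall>T :: 'x \<Rightarrow>\<^sub>L 'e::banach_lattice. semi_compact T \<longrightarrow> almost_L_weakly_compact T)
           \<longleftrightarrow> order_continuous_norm TYPE('e)"
proof
  assume all: "\<forall>T :: 'x \<Rightarrow>\<^sub>L 'e. semi_compact T \<longrightarrow> almost_L_weakly_compact T"
  show "order_continuous_norm TYPE('e)"
  proof (rule order_continuous_norm_if_disjoint_null)
    fix u :: 'e and z assume "disjoint_sequence z" "\<And>n. 0 \<le> z n \<and> z n \<le> u"
    with all show "z \<longlonglongrightarrow> 0"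
      by (intro disjoint_null_if_semi_compact_almost_L_weakly_compact[OF assms]) auto
  qed
next
  assume "order_continuous_norm TYPE('e)"
  then show "\<forall>T :: 'x \<Rightarrow>\<^sub>L 'e. semi_compact T \<longrightarrow> almost_L_weakly_compact T"
    by (blast intro: almost_L_weakly_compact_if_semi_compact)
qed

end
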